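(* There is an absolute constant $C>0$ such that for infinitely many $n$ there exist a connected graph $G=(V,E)$ on $n$ nodes and a parameter $\lambda\in(0,1)$ for which the optimal value of the \textsc{LambdaCC} integer program on $(G,\lambda)$ is at least $C\log n$ times the optimal value of its LP relaxation. In other words, there exist choices of $\lambda$ for which the integrality gap of the \textsc{LambdaCC} LP relaxation is $\Omega(\log n)$.
   Context: \textsc{LambdaCC} (Lambda Correlation Clustering): given an undirected graph $G=(V,E)$ on $n$ nodes and $\lambda\in(0,1)$, a clustering is a partition of $V$. Its cost is $(1-\lambda)$ times the number of edges of $E$ whose endpoints lie in different clusters, plus $\lambda$ times the number of unordered pairs of distinct nodes $\{i,j\}\notin E$ whose nodes lie in the same cluster. Equivalently, the integer program has variables $x_{ij}\in\{0,1\}$ for unordered pairs $i\neq j$, with $x_{ij}=1$ meaning $i,j$ are separated. It minimizes $\sum_{(i,j)\in E}(1-\lambda)x_{ij}+\sum_{(i,j)\notin E}\lambda(1-x_{ij})$ subject to $x_{ij}\le x_{ik}+x_{jk}$ for all distinct $i,j,k$. The LP relaxation is the same program with $x_{ij}\in\{0,1\}$ replaced by $0\le x_{ij}\le 1$. The integrality gap is the ratio of the integer optimum to the LP optimum. *)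

theory Defs
  imports Complex_Main
begin

text \<open>
  A finite undirected simple graph is given by a vertex set \<open>V\<close> and a set \<open>E\<close> of two-element
  subsets of \<open>V\<close>.
\<close>

definition node_pairs :: "'a set \<Rightarrow> 'a set set" where
  "node_pairs V = {e. e \<subseteq> V \<and> card e = 2}"

definition simple_graph :: "'a set \<Rightarrow> 'a set set \<Rightarrow> bool" where
  "simple_graph V E \<longleftrightarrow> finite V \<and> E \<subseteq> node_pairs V"

definition connected_graph :: "'a set \<Rightarrow> 'a set set \<Rightarrow> bool" where
  "connected_graph V E \<longleftrightarrow>
     simple_graph V E \<and> V \<noteq> {} \<and> (\<forall>u\<in>V. \<forall>v\<in>V. (u, v) \<in> {(a, b). {a, b} \<in> E}\<^sup>*)"

text \<open>
  The variables \<open>x\<^sub>i\<^sub>j\<close> are indexed by unordered pairs, so they form a function on sets; only its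
  values on \<open>node_pairs V\<close> matter.
\<close>

definition lcc_objective :: "'a set \<Rightarrow> 'a set set \<Rightarrow> real \<Rightarrow> ('a set \<Rightarrow> real) \<Rightarrow> real" where
  "lcc_objective V E lam x =
     (\<Sum>e\<in>E. (1 - lam) * x e) + (\<Sum>e\<in>node_pairs V - E. lam * (1 - x e))"

definition triangle_constraints :: "'a set \<Rightarrow> ('a set \<Rightarrow> real) \<Rightarrow> bool" where
  "triangle_constraints V x \<longleftrightarrow>
     (\<forall>i\<in>V. \<forall>j\<in>V. \<forall>k\<in>V. i \<noteq> j \<and> i \<noteq> k \<and> j \<noteq> k \<longrightarrow> x {i, j} \<le> x {i, k} + x {j, k})"

definition lcc_ip_feasible :: "'a set \<Rightarrow> ('a set \<Rightarrow> real) set" where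
  "lcc_ip_feasible V = {x. (\<forall>e\<in>node_pairs V. x e \<in> {0, 1}) \<and> triangle_constraints V x}"

definition lcc_lp_feasible :: "'a set \<Rightarrow> ('a set \<Rightarrow> real) set" where
  "lcc_lp_feasible V = {x. (\<forall>e\<in>node_pairs V. 0 \<le> x e \<and> x e \<le> 1) \<and> triangle_constraints V x}"

definition lcc_ip_opt :: "'a set \<Rightarrow> 'a set set \<Rightarrow> real \<Rightarrow> real" where
  "lcc_ip_opt V E lam = (INF x\<in>lcc_ip_feasible V. lcc_objective V E lam x)"

definition lcc_lp_opt :: "'a set \<Rightarrow> 'a set set \<Rightarrow> real \<Rightarrow> real" where
  "lcc_lp_opt V E lam = (INF x\<in>lcc_lp_feasible V. lcc_objective V E lam x)"

definition lcc_integrality_gap :: "'a set \<Rightarrow> 'a set set \<Rightarrow> real \<Rightarrow> real" where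
  "lcc_integrality_gap V E lam = lcc_ip_opt V E lam / lcc_lp_opt V E lam"

text \<open>
  The infima above are taken over nonempty sets of reals that are bounded below.
\<close>

lemma lcc_ip_feasible_nonempty: "lcc_ip_feasible V \<noteq> {}"
proof -
  have "(\<lambda>_. 0) \<in> lcc_ip_feasible V"
    by (simp add: lcc_ip_feasible_def triangle_constraints_def)
  then show ?thesis by blast
qed

lemma lcc_ip_feasible_subset: "lcc_ip_feasible V \<subseteq> lcc_lp_feasible V"
  unfolding lcc_ip_feasible_def lcc_lp_feasible_def by fastforce

lemma lcc_objective_nonneg:
  assumes "simple_graph V E" "0 < lam" "lam < 1" "x \<in> lcc_lp_feasible V"
  shows "0 \<le> lcc_objective V E lam x"
proof -
  have "0 \<le> (\<Sum>e\<in>E. (1 - lam) * x e)"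
    using assms by (intro sum_nonneg) (auto simp: simple_graph_def lcc_lp_feasible_def)
  moreover have "0 \<le> (\<Sum>e\<in>node_pairs V - E. lam * (1 - x e))"
    using assms by (intro sum_nonneg) (auto simp: lcc_lp_feasible_def)
  ultimately show ?thesis by (simp add: lcc_objective_def)
qed

lemma lcc_lp_bdd_below:
  assumes "simple_graph V E" "0 < lam" "lam < 1"
  shows "bdd_below (lcc_objective V E lam ` lcc_lp_feasible V)"
  using lcc_objective_nonneg[OF assms] by (intro bdd_belowI2[where m = 0]) auto

end

theory Submission imports Defs begin

text \<open>
  Take a bounded-degree graph on \<open>n\<close> nodes with \<open>O(n)\<close> edges in which every node set of size
  between \<open>n/3\<close> and \<open>2n/3\<close> is left by more than \<open>n\<close> edges, and let \<open>\<lambda> = 1/n\<close>. Setting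
  \<open>x\<^sub>i\<^sub>j = min 1 (dist i j / D)\<close> with \<open>D\<close> a small multiple of \<open>ln n\<close> makes the edges cost \<open>O(n/D)\<close>
  in total; only about \<open>n\<^bsup>3/2\<^esup>\<close> pairs have distance below \<open>D\<close>, so the non-edges cost only
  \<open>O(\<surd>n)\<close>. In contrast, a clustering either has a cluster with \<open>n/3\<close> nodes, which contains
  \<open>\<Omega>(n\<^sup>2)\<close> non-edges, or some union of its clusters is a balanced set, whose cut edges are all
  separated; both cost \<open>\<Omega>(n)\<close>.

  Balanced expansion is obtained without randomness. Starting from a path, edges between nodes of
  small degree are added one at a time so that the sum of \<open>2\<close> to the power \<open>-cut S\<close> over all balanced
  \<open>S\<close> shrinks by a constant factor at each step. This sum starts at no more than \<open>2\<^sup>n\<close>, so \<open>O(n)\<close> steps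
  bring it below \<open>2\<^bsup>-n\<^esup>\<close>, and then every balanced cut has more than \<open>n\<close> edges.
\<close>

section \<open>Greedy construction of balanced expanders\<close>

definition degree :: "'a set set \<Rightarrow> 'a \<Rightarrow> nat" where
  "degree E v = card {e \<in> E. v \<in> e}"

text \<open>The first argument need not be the edge set of the graph: below it is also a set of
  candidate edges, or all node pairs.\<close>

definition cut :: "'a set set \<Rightarrow> 'a set \<Rightarrow> 'a set set" where
  "cut E S = {e \<in> E. e \<inter> S \<noteq> {} \<and> e - S \<noteq> {}}"

definition balanced :: "'a set \<Rightarrow> 'a set \<Rightarrow> bool" where
  "balanced V S \<longleftrightarrow> S \<subseteq> V \<and> card V \<le> 3 * card S \<and> 3 * card S \<le> 2 * card V"

definition cut_potential :: "'a set \<Rightarrow> 'a set set \<Rightarrow> real" where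
  "cut_potential V E = (\<Sum>S | balanced V S. (1/2) ^ card (cut E S))"

section \<open>Counting facts and the greedy step\<close>

lemma finite_node_pairs: "finite V \<Longrightarrow> finite (node_pairs V)"
  unfolding node_pairs_def by (rule finite_subset[of _ "Pow V"]) auto

lemma simple_graph_finite_edges: "simple_graph V E \<Longrightarrow> finite E"
  unfolding simple_graph_def using finite_node_pairs finite_subset by blast

lemma card_node_pairs: "finite V \<Longrightarrow> card (node_pairs V) = card V choose 2"
  unfolding node_pairs_def by (rule n_subsets)

lemma real_card_node_pairs:
  "finite V \<Longrightarrow> real (card (node_pairs V)) = real (card V) * (real (card V) - 1) / 2"
  by (cases "card V") (auto simp: card_node_pairs choose_two real_of_nat_div field_simps)

lemma finite_balanced: "finite V \<Longrightarrow> finite {S. balanced V S}"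
  by (rule finite_subset[of _ "Pow V"]) (auto simp: balanced_def)

lemma sum_degree:
  assumes "simple_graph V E"
  shows "(\<Sum>v\<in>V. degree E v) = 2 * card E"
proof -
  have fin: "finite V" "finite E"
    using assms simple_graph_finite_edges by (auto simp: simple_graph_def)
  have "(\<Sum>v\<in>V. degree E v) = (\<Sum>v\<in>V. \<Sum>e\<in>E. if v \<in> e then 1 else 0)"
    using fin by (simp add: degree_def sum.If_cases Int_def)
  also have "\<dots> = (\<Sum>e\<in>E. \<Sum>v\<in>V. if v \<in> e then 1 else 0)"
    by (rule sum.swap)
  also have "\<dots> = (\<Sum>e\<in>E. 2)"
  proof (rule sum.cong)
    fix e assume "e \<in> E"
    then have "e \<subseteq> V" "card e = 2"
      using assms by (auto simp: simple_graph_def node_pairs_def)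
    moreover from this have "V \<inter> {v. v \<in> e} = e" by auto
    ultimately show "(\<Sum>v\<in>V. if v \<in> e then 1 else 0) = (2::nat)"
      using fin by (simp add: sum.If_cases)
  qed simp
  finally show ?thesis by simp
qed

text \<open>Markov's inequality for degrees: they sum to at most 202 n, and 2424 = 12 * 202.\<close>

lemma card_high_degree:
  assumes "simple_graph V E" "card E \<le> 101 * card V"
  shows "12 * card {v \<in> V. 2424 \<le> degree E v} \<le> card V"
proof -
  let ?H = "{v \<in> V. 2424 \<le> degree E v}"
  have "card ?H * 2424 \<le> (\<Sum>v\<in>?H. degree E v)"
    using sum_bounded_below[of ?H 2424 "degree E"] by simp
  also have "\<dots> \<le> (\<Sum>v\<in>V. degree E v)"
    using assms(1) by (intro sum_mono2) (auto simp: simple_graph_def)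
  finally show ?thesis
    using sum_degree[OF assms(1)] assms(2) by linarith
qed

text \<open>Discarding the at most n/12 saturated nodes leaves at least n/3 - n/12 = n/4 nodes of
  \<open>L\<close> on each side of \<open>S\<close>, hence n^2/16 crossing pairs. At most 101 n of
  them are edges already, which is at most half since n >= 3232 = 2 * 16 * 101. The remaining n^2/32
  are a sixteenth of the at most n^2/2 candidates.\<close>

lemma card_cut_new_pairs:
  assumes G: "simple_graph V E" and E: "card E \<le> 101 * card V" and n: "3232 \<le> card V"
    and S: "balanced V S"
  defines "L \<equiv> {v \<in> V. degree E v < 2424}"
  shows "card (node_pairs L - E) \<le> 16 * card (cut (node_pairs L - E) S)"
    and "0 < card (cut (node_pairs L - E) S)"
proof -
  let ?A = "node_pairs L - E"
  let ?P = "(S \<inter> L) \<times> (L - S)"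
  let ?f = "\<lambda>(a, b). {a, b}"
  have fin: "finite V" "finite E" "finite L" "finite S"
    using G S simple_graph_finite_edges[OF G]
    by (auto simp: simple_graph_def L_def balanced_def intro: finite_subset)
  have H: "12 * card (V - L) \<le> card V"
  proof -
    have "V - L = {v \<in> V. 2424 \<le> degree E v}" by (auto simp: L_def)
    with card_high_degree[OF G E] show ?thesis by simp
  qed
  have LV: "L \<subseteq> V" by (auto simp: L_def)
  have "card S = card (S \<inter> L) + card (S - L)"
    using fin(4) by (rule card_Int_Diff)
  moreover have "card (S - L) \<le> card (V - L)"
    using S fin by (intro card_mono) (auto simp: balanced_def)
  ultimately have a: "card V \<le> 4 * card (S \<inter> L)"
    using S H by (auto simp: balanced_def)
  have "card (V - S) = card V - card S"
    using S fin by (intro card_Diff_subset) (auto simp: balanced_def)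
  moreover have "card (V - S) \<le> card ((L - S) \<union> (V - L))"
    using fin LV by (intro card_mono) auto
  moreover have "card ((L - S) \<union> (V - L)) \<le> card (L - S) + card (V - L)"
    by (rule card_Un_le)
  ultimately have b: "card V \<le> 4 * card (L - S)"
    using S H by (auto simp: balanced_def)
  have "inj_on ?f ?P"
    by (auto simp: inj_on_def doubleton_eq_iff)
  then have "card (S \<inter> L) * card (L - S) = card (?f ` ?P)"
    by (simp add: card_image card_cartesian_product)
  also have "\<dots> \<le> card (cut ?A S \<union> E)"
  proof (rule card_mono)
    show "finite (cut ?A S \<union> E)"
      using fin by (simp add: cut_def finite_node_pairs)
    show "?f ` ?P \<subseteq> cut ?A S \<union> E"
      by (auto simp: cut_def node_pairs_def card_2_iff)
  qed
  also have "\<dots> \<le> card (cut ?A S) + card E" by (rule card_Un_le)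
  finally have c: "card (S \<inter> L) * card (L - S) \<le> card (cut ?A S) + card E" .
  have "card V * card V \<le> (4 * card (S \<inter> L)) * (4 * card (L - S))"
    using a b by (rule mult_le_mono)
  then have "card V * card V \<le> 16 * (card (S \<inter> L) * card (L - S))" by simp
  with c E have "card V * card V \<le> 16 * card (cut ?A S) + 1616 * card V" by linarith
  moreover have "3232 * card V \<le> card V * card V" using n by simp
  ultimately have d: "card V * card V \<le> 32 * card (cut ?A S)" by linarith
  have "card ?A \<le> card (node_pairs V)"
    using fin LV by (intro card_mono finite_node_pairs) (auto simp: node_pairs_def)
  also have "\<dots> = card V * (card V - 1) div 2"
    using fin by (simp add: card_node_pairs choose_two)
  also have "\<dots> \<le> card V * card V div 2"
    by (intro div_le_mono mult_le_mono) auto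
  finally show "card ?A \<le> 16 * card (cut ?A S)" using d by linarith
  have "0 < card V * card V" using n by simp
  with d show "0 < card (cut ?A S)" by linarith
qed

lemma ex_balanced:
  assumes "finite V" "2 \<le> card V"
  shows "\<exists>S. balanced V S"
proof -
  obtain S where "S \<subseteq> V" "card S = card V div 2"
    by (metis obtain_subset_with_card_n div_le_dividend)
  with assms have "balanced V S" by (auto simp: balanced_def)
  then show ?thesis ..
qed

lemma card_cut_insert:
  assumes "finite E" "e \<notin> E"
  shows "card (cut (insert e E) S) = card (cut E S) + (if e \<inter> S \<noteq> {} \<and> e - S \<noteq> {} then 1 else 0)"
proof -
  have "cut (insert e E) S = (if e \<inter> S \<noteq> {} \<and> e - S \<noteq> {} then insert e (cut E S) else cut E S)"
    by (auto simp: cut_def)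
  moreover have "e \<notin> cut E S" "finite (cut E S)" using assms by (auto simp: cut_def)
  ultimately show ?thesis by simp
qed

text \<open>Averaging over all admissible new edges: each balanced cut is hit by at least a sixteenth
  of them, and a hit halves its term in the potential.\<close>

lemma ex_edge_decreasing_potential:
  assumes G: "simple_graph V E" and E: "card E \<le> 101 * card V" and n: "3232 \<le> card V"
  shows "\<exists>e. e \<in> node_pairs V - E \<and> (\<forall>v\<in>e. degree E v < 2424) \<and>
    cut_potential V (insert e E) \<le> 31/32 * cut_potential V E"
proof -
  define A where "A = node_pairs {v \<in> V. degree E v < 2424} - E"
  have fin: "finite V" "finite E" "finite A"
    using G simple_graph_finite_edges[OF G] by (auto simp: simple_graph_def A_def finite_node_pairs)
  note new = card_cut_new_pairs[OF G E n, folded A_def]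
  \<comment> \<open>The strict inequality between sums over \<open>A\<close> below needs
    \<open>A\<close> to be nonempty.\<close>
  obtain S0 where "balanced V S0" using ex_balanced fin n by fastforce
  then have "A \<noteq> {}" using new(2) by (auto simp: cut_def)
  have avg: "(\<Sum>e\<in>A. (1/2) ^ card (cut (insert e E) S)) \<le> 31/32 * card A * (1/2::real) ^ card (cut E S)"
    if "balanced V S" for S
  proof -
    let ?w = "(1/2::real) ^ card (cut E S)"
    have "(\<Sum>e\<in>A. (1/2) ^ card (cut (insert e E) S)) = (\<Sum>e\<in>A. ?w - (if e \<in> cut A S then ?w / 2 else 0))"
      using fin by (intro sum.cong) (auto simp: card_cut_insert A_def, auto simp: cut_def)
    also have "\<dots> = card A * ?w - card (cut A S) * (?w / 2)"
    proof -
      have "A \<inter> {e. e \<in> cut A S} = cut A S" by (auto simp: cut_def)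
      then show ?thesis using fin by (simp add: sum_subtractf sum.If_cases)
    qed
    \<comment> \<open>A sixteenth of the candidates each save half of the weight: 1 - 1/32 =
      31/32.\<close>
    also have "\<dots> \<le> card A * ?w - card A / 16 * (?w / 2)"
      using new(1)[OF that] by (intro diff_left_mono mult_right_mono) auto
    finally show ?thesis by (simp add: field_simps)
  qed
  have "\<exists>e\<in>A. cut_potential V (insert e E) \<le> 31/32 * cut_potential V E"
  proof (rule ccontr)
    assume "\<not> ?thesis"
    then have "(\<Sum>e\<in>A. 31/32 * cut_potential V E) < (\<Sum>e\<in>A. cut_potential V (insert e E))"
      using fin \<open>A \<noteq> {}\<close> by (intro sum_strict_mono) auto
    also have "\<dots> = (\<Sum>S | balanced V S. \<Sum>e\<in>A. (1/2) ^ card (cut (insert e E) S))"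
      unfolding cut_potential_def by (rule sum.swap)
    also have "\<dots> \<le> (\<Sum>S | balanced V S. 31/32 * card A * (1/2) ^ card (cut E S))"
      using avg by (intro sum_mono) auto
    also have "\<dots> = (\<Sum>e\<in>A. 31/32 * cut_potential V E)"
      by (simp add: cut_potential_def sum_distrib_left mult_ac)
    finally show False by simp
  qed
  then show ?thesis by (auto simp: A_def node_pairs_def)
qed

text \<open>New edges join only nodes of degree below 2424, so no degree exceeds 2424. The bound on
  \<open>m\<close> keeps the edge count within the 101 n that the averaging step requires.\<close>

lemma greedy_edges:
  assumes G: "simple_graph V E0" and E0: "card E0 \<le> card V" and n: "3232 \<le> card V"
    and deg: "\<And>v. degree E0 v \<le> 2424" and m: "m \<le> 100 * card V"
  shows "\<exists>E. E0 \<subseteq> E \<and> simple_graph V E \<and> card E \<le> card V + m \<and> (\<forall>v. degree E v \<le> 2424) \<and>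
    cut_potential V E \<le> (31/32) ^ m * cut_potential V E0"
  using m
proof (induction m)
  case 0
  then show ?case using G E0 deg by auto
next
  case (Suc m)
  then obtain E where E: "E0 \<subseteq> E" "simple_graph V E" "card E \<le> card V + m"
      "\<And>v. degree E v \<le> 2424" "cut_potential V E \<le> (31/32) ^ m * cut_potential V E0"
    by auto
  then obtain e where e: "e \<in> node_pairs V - E" "\<And>v. v \<in> e \<Longrightarrow> degree E v < 2424"
      "cut_potential V (insert e E) \<le> 31/32 * cut_potential V E"
    using ex_edge_decreasing_potential[of V E] n Suc.prems by auto
  have fin: "finite E" using E simple_graph_finite_edges by blast
  have "degree (insert e E) v \<le> 2424" for v
  proof -
    have "{e' \<in> insert e E. v \<in> e'} = (if v \<in> e then insert e {e' \<in> E. v \<in> e'} else {e' \<in> E. v \<in> e'})"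
      by auto
    then show ?thesis using E(4)[of v] e fin by (auto simp: degree_def Suc_le_eq)
  qed
  moreover have "simple_graph V (insert e E)"
    using E e by (auto simp: simple_graph_def)
  moreover have "card (insert e E) \<le> card V + Suc m"
    using E e fin by auto
  moreover have "cut_potential V (insert e E) \<le> (31/32) ^ Suc m * cut_potential V E0"
    using e(3) E(5) by simp
  ultimately show ?case using E(1) by blast
qed

lemma cut_potential_le:
  assumes "finite V"
  shows "cut_potential V E \<le> 2 ^ card V"
proof -
  have "cut_potential V E \<le> (\<Sum>S | balanced V S. 1)"
    unfolding cut_potential_def by (intro sum_mono power_le_one) auto
  also have "\<dots> \<le> (\<Sum>S\<in>Pow V. 1)"
    using assms by (intro sum_mono2) (auto simp: balanced_def)
  finally show ?thesis using assms by (simp add: card_Pow)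
qed

text \<open>A single balanced cut with at most \<open>k\<close> edges would already contribute
  (1/2)^k to the potential.\<close>

lemma card_cut_gt_of_potential:
  assumes "finite V" "balanced V S" "cut_potential V E < (1/2) ^ k"
  shows "k < card (cut E S)"
proof (rule ccontr)
  assume "\<not> ?thesis"
  then have "(1/2::real) ^ k \<le> (1/2) ^ card (cut E S)"
    by (intro power_decreasing) auto
  also have "\<dots> \<le> cut_potential V E"
    unfolding cut_potential_def using assms finite_balanced by (intro member_le_sum) auto
  finally show False using assms by simp
qed

section \<open>The starting path and the resulting expander\<close>

lemma connected_graph_mono:
  assumes "connected_graph V E" "E \<subseteq> E'" "simple_graph V E'"
  shows "connected_graph V E'"
proof -
  have "{(a, b). {a, b} \<in> E}\<^sup>* \<subseteq> {(a, b). {a, b} \<in> E'}\<^sup>*"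
    using assms by (intro rtrancl_mono) auto
  then show ?thesis using assms unfolding connected_graph_def by blast
qed

lemma path_graph:
  fixes n :: nat
  assumes "0 < n"
  defines "E \<equiv> (\<lambda>i. {i, Suc i}) ` {..<n - 1}"
  shows "connected_graph {..<n} E" "card E \<le> n" "degree E v \<le> 2"
proof -
  let ?R = "{(a, b). {a, b} \<in> E}"
  have G: "simple_graph {..<n} E"
    by (auto simp: simple_graph_def node_pairs_def E_def)
  have "(0, v) \<in> ?R\<^sup>*" if "v < n" for v
    using that
  proof (induction v)
    case (Suc v)
    then have "(v, Suc v) \<in> ?R" by (auto simp: E_def)
    with Suc show ?case by (meson Suc_lessD rtrancl.rtrancl_into_rtrancl)
  qed simp
  moreover have "sym (?R\<^sup>*)"
    by (intro sym_rtrancl) (auto simp: sym_def insert_commute)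
  ultimately have "(u, v) \<in> ?R\<^sup>*" if "u < n" "v < n" for u v
    using that by (meson rtrancl_trans symD)
  then show "connected_graph {..<n} E"
    using G assms by (auto simp: connected_graph_def)
  show "card E \<le> n"
    unfolding E_def by (rule order_trans[OF card_image_le]) auto
  \<comment> \<open>For v = 0 the second set collapses to {0}, which is harmless for an upper
    bound.\<close>
  have "{e \<in> E. v \<in> e} \<subseteq> {{v, Suc v}, {v - 1, v}}"
    by (auto simp: E_def)
  then have "card {e \<in> E. v \<in> e} \<le> card {{v, Suc v}, {v - 1, v}}"
    by (intro card_mono) auto
  also have "\<dots> \<le> 2" by (simp add: card_insert_if)
  finally show "degree E v \<le> 2" by (simp add: degree_def)
qed

theorem ex_balanced_expander:
  fixes n :: nat
  assumes n: "3232 \<le> n"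
  shows "\<exists>E. connected_graph {..<n} E \<and> card E \<le> 101 * n \<and> (\<forall>v. degree E v \<le> 2424) \<and>
    (\<forall>S. balanced {..<n} S \<longrightarrow> n < card (cut E S))"
proof -
  obtain E0 where E0: "connected_graph {..<n} E0" "card E0 \<le> n" "\<And>v. degree E0 v \<le> 2"
    using path_graph[of n] n by fastforce
  have "degree E0 v \<le> 2424" for v using E0(3)[of v] by simp
  moreover have "simple_graph {..<n} E0" using E0 by (simp add: connected_graph_def)
  ultimately obtain E where E: "E0 \<subseteq> E" "simple_graph {..<n} E" "card E \<le> n + 100 * n"
      "\<And>v. degree E v \<le> 2424"
      "cut_potential {..<n} E \<le> (31/32) ^ (100 * n) * cut_potential {..<n} E0"
    using greedy_edges[of "{..<n}" E0 "100 * n"] E0(2) n by fastforce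
  have "cut_potential {..<n} E \<le> (31/32) ^ (100 * n) * 2 ^ n"
    using E(5) by (rule order_trans) (use cut_potential_le[of "{..<n}" E0] in simp)
  also have "\<dots> = ((31/32) ^ 100 * 2) ^ n"
    by (simp only: power_mult power_mult_distrib)
  \<comment> \<open>One hundred rounds per node suffice because (31/32)^100 < 1/4: one factor 1/2
    cancels the initial 2^n, the other reaches the target.\<close>
  also have "\<dots> < (1/2) ^ n"
  proof (rule power_strict_mono)
    show "(31/32) ^ 100 * 2 < (1/2 :: real)" by (simp add: power_divide)
  qed (use n in auto)
  finally have "n < card (cut E S)" if "balanced {..<n} S" for S
    using card_cut_gt_of_potential[of "{..<n}" S E n] that by simp
  then show ?thesis
    using E(1-4) connected_graph_mono[OF E0(1)] by (intro exI[of _ E]) auto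
qed

section \<open>The integer optimum\<close>

text \<open>In the absence of a large cluster, a smallest union of clusters with at least \<open>n/3\<close> nodes has
  at most \<open>2n/3\<close>, since removing one cluster takes it below \<open>n/3\<close>.\<close>

lemma ip_cluster_or_balanced_closed:
  assumes V: "finite V" "V \<noteq> {}" and x: "x \<in> lcc_ip_feasible V"
  shows "(\<exists>K\<subseteq>V. card V \<le> 3 * card K \<and> (\<forall>e\<in>node_pairs K. x e = 0)) \<or>
    (\<exists>S. balanced V S \<and> (\<forall>e\<in>cut (node_pairs V) S. x e = 1))"
proof -
  \<comment> \<open>\<open>K v\<close> is the cluster of \<open>v\<close>. Reflexivity is put in by
    hand, since the value of \<open>x\<close> on singletons is unconstrained. The
    \<open>closed\<close> sets are the unions of clusters.\<close>
  define K where "K v = {u \<in> V. u = v \<or> x {u, v} = 0}" for v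
  define closed where "closed S \<longleftrightarrow> S \<subseteq> V \<and> (\<forall>v\<in>S. K v \<subseteq> S)" for S
  have x01: "x {a, b} = 0 \<or> x {a, b} = 1" if "a \<in> V" "b \<in> V" "a \<noteq> b" for a b
  proof -
    have "{a, b} \<in> node_pairs V" using that by (simp add: node_pairs_def)
    then show ?thesis using x by (auto simp: lcc_ip_feasible_def)
  qed
  have trans: "x {a, c} = 0" if "a \<in> V" "b \<in> V" "c \<in> V" "a \<noteq> c" "a \<in> K b" "c \<in> K b" for a b c
  proof (cases "a = b \<or> c = b")
    case True
    then show ?thesis using that by (auto simp: K_def insert_commute)
  next
    case False
    then have "x {a, c} \<le> x {a, b} + x {c, b}"
      using x that by (auto simp: lcc_ip_feasible_def triangle_constraints_def)
    then show ?thesis using False that x01[of a c] by (auto simp: K_def)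
  qed
  have K_sym: "u \<in> K v" if "v \<in> K u" "u \<in> V" for u v
    using that by (auto simp: K_def insert_commute)
  show ?thesis
  proof (cases "\<exists>v\<in>V. card V \<le> 3 * card (K v)")
    case True
    then obtain v where v: "v \<in> V" "card V \<le> 3 * card (K v)" by blast
    have "x e = 0" if "e \<in> node_pairs (K v)" for e
    proof -
      obtain a b where "e = {a, b}" "a \<noteq> b" "a \<in> K v" "b \<in> K v"
        using \<open>e \<in> node_pairs (K v)\<close> by (auto simp: node_pairs_def card_2_iff)
      then show ?thesis using trans[of a v b] v by (auto simp: K_def)
    qed
    moreover have "K v \<subseteq> V" by (auto simp: K_def)
    ultimately show ?thesis using v by blast
  next
    case small: False
    have ex: "closed V \<and> card V \<le> 3 * card V" by (auto simp: closed_def K_def)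
    obtain S where S: "closed S" "card V \<le> 3 * card S"
      and least: "\<And>T. closed T \<and> card V \<le> 3 * card T \<Longrightarrow> card S \<le> card T"
      using ex_has_least_nat[of "\<lambda>T. closed T \<and> card V \<le> 3 * card T", OF ex] by blast
    have SV: "S \<subseteq> V" "finite S" using S V finite_subset by (auto simp: closed_def)
    have "3 * card S \<le> 2 * card V"
    proof (rule ccontr)
      assume large: "\<not> ?thesis"
      then obtain v where v: "v \<in> S" by fastforce
      then have KS: "K v \<subseteq> S" "v \<in> K v" using S SV by (auto simp: closed_def K_def)
      \<comment> \<open>Deleting a whole cluster leaves a union of clusters, still with more than
        2n/3 - n/3 nodes, which contradicts minimality.\<close>
      have "closed (S - K v)"
        unfolding closed_def
      proof (intro conjI ballI subsetI)
        fix u w assume u: "u \<in> S - K v" and w: "w \<in> K u"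
        have V: "u \<in> V" "v \<in> V" "w \<in> V" using u v w SV by (auto simp: K_def)
        have "w \<notin> K v"
        proof
          assume "w \<in> K v"
          then have "v \<in> K w" "u \<in> K w" using K_sym V w by auto
          then have "u \<in> K v" using trans[of u w v] V by (auto simp: K_def)
          then show False using u by simp
        qed
        then show "w \<in> S - K v" using u w S by (auto simp: closed_def)
      qed (use SV in auto)
      moreover have card: "card (S - K v) = card S - card (K v)"
        using KS SV finite_subset by (intro card_Diff_subset) auto
      moreover have "3 * card (K v) < card V" using small v SV by fastforce
      ultimately have "card S \<le> card (S - K v)" using large by (intro least) auto
      moreover have "card (K v) > 0"
        using KS SV by (metis card_gt_0_iff empty_iff finite_subset)
      ultimately show False using card card_mono[OF SV(2) KS(1)] by linarith
    qed
    then have "balanced V S" using S SV by (auto simp: balanced_def)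
    moreover have "x e = 1" if e_cut: "e \<in> cut (node_pairs V) S" for e
    proof -
      obtain a b where ab: "a \<in> e" "a \<in> S" "b \<in> e" "b \<notin> S" using e_cut by (auto simp: cut_def)
      moreover have "e \<subseteq> V" "card e = 2" using e_cut by (auto simp: cut_def node_pairs_def)
      ultimately have e: "e = {a, b}" "a \<noteq> b" "a \<in> S" "b \<in> V" "b \<notin> S"
        by (auto simp: card_2_iff)
      then have "b \<notin> K a" using S by (auto simp: closed_def)
      then show ?thesis using e x01[of a b] SV by (auto simp: K_def insert_commute)
    qed
    ultimately show ?thesis by blast
  qed
qed

text \<open>Each case uses just one of the two sums of the objective: non-edges inside a large
  cluster, or edges across a balanced set.\<close>

lemma lcc_ip_opt_ge:
  assumes G: "simple_graph V E" and E: "card E \<le> 101 * card V" and n: "3672 \<le> card V"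
    and exp: "\<And>S. balanced V S \<Longrightarrow> card V < card (cut E S)"
  shows "real (card V) / 36 \<le> lcc_ip_opt V E (1 / card V)"
  unfolding lcc_ip_opt_def
proof (rule cINF_greatest)
  fix x assume x: "x \<in> lcc_ip_feasible V"
  let ?n = "real (card V)"
  have fin: "finite V" "V \<noteq> {}" "finite E"
    using G n simple_graph_finite_edges by (auto simp: simple_graph_def)
  have EV: "E \<subseteq> node_pairs V" using G by (simp add: simple_graph_def)
  have x01: "0 \<le> x e" "x e \<le> 1" if "e \<in> node_pairs V" for e
    using x that by (auto simp: lcc_ip_feasible_def)
  have lam: "0 \<le> 1 / ?n" "1 / ?n \<le> 1 / 2" using n by (auto simp: field_simps)
  have sumE: "0 \<le> (\<Sum>e\<in>E. (1 - 1 / ?n) * x e)"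
    using EV x01 lam by (intro sum_nonneg mult_nonneg_nonneg) auto
  have sumN: "0 \<le> (\<Sum>e\<in>node_pairs V - E. 1 / ?n * (1 - x e))"
    using x01 lam by (intro sum_nonneg mult_nonneg_nonneg) auto
  consider K where "K \<subseteq> V" "card V \<le> 3 * card K" "\<forall>e\<in>node_pairs K. x e = 0"
    | S where "balanced V S" "\<forall>e\<in>cut (node_pairs V) S. x e = 1"
    using ip_cluster_or_balanced_closed[OF fin(1,2) x] by blast
  then show "?n / 36 \<le> lcc_objective V E (1 / ?n) x"
  proof cases
    case 1
    let ?k = "real (card K)"
    have finK: "finite K" using 1 fin finite_subset by blast
    have kn: "?n / 3 \<le> ?k" using 1 by linarith
    have "?n / 3 * (?n / 3 - 1) \<le> ?k * (?k - 1)"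
      using kn n by (intro mult_mono) auto
    moreover have "real (card (node_pairs K)) - card E \<le> card (node_pairs K - E)"
      using diff_card_le_card_Diff[OF fin(3), of "node_pairs K"] by linarith
    moreover have "real (card E) \<le> 101 * ?n" using E by linarith
    \<comment> \<open>\<open>K\<close> has at least n^2/18 - n/6 pairs. Half of the main term,
      n^2/36, must absorb n/6 and the at most 101 n edges; 3672 = 36 * 102 is enough.\<close>
    moreover have "3672 * ?n \<le> ?n * ?n" using n by (intro mult_right_mono) auto
    ultimately have "?n * ?n / 36 \<le> card (node_pairs K - E)"
      using real_card_node_pairs[OF finK] by (simp add: field_simps)
    then have "?n / 36 \<le> 1 / ?n * card (node_pairs K - E)"
      using n by (simp add: field_simps)
    also have "\<dots> = (\<Sum>e\<in>node_pairs K - E. 1 / ?n * (1 - x e))"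
      using 1 by simp
    also have "\<dots> \<le> (\<Sum>e\<in>node_pairs V - E. 1 / ?n * (1 - x e))"
      using 1 fin finite_node_pairs x01 lam
      by (intro sum_mono2 mult_nonneg_nonneg) (auto simp: node_pairs_def)
    finally show ?thesis using sumE by (simp add: lcc_objective_def)
  next
    case 2
    have "?n / 36 \<le> 1 / 2 * ?n" by simp
    also have "\<dots> \<le> (1 - 1 / ?n) * card (cut E S)"
      using exp[OF 2(1)] lam by (intro mult_mono) auto
    also have "\<dots> = (\<Sum>e\<in>cut E S. (1 - 1 / ?n) * x e)"
      using 2(2) EV by (auto simp: cut_def subset_iff)
    also have "\<dots> \<le> (\<Sum>e\<in>E. (1 - 1 / ?n) * x e)"
      using EV x01 lam fin by (intro sum_mono2 mult_nonneg_nonneg) (auto simp: cut_def)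
    finally show ?thesis using sumN by (simp add: lcc_objective_def)
  qed
qed (rule lcc_ip_feasible_nonempty)

section \<open>The LP optimum\<close>

text \<open>The relation is reflexive, so its \<open>r\<close>-th power relates nodes at distance at most \<open>r\<close>.\<close>

definition step_rel :: "'a set set \<Rightarrow> ('a \<times> 'a) set" where
  "step_rel E = {(a, b). a = b \<or> {a, b} \<in> E}"

text \<open>Graph distance, taken on sets because the LP variables are indexed by unordered pairs;
  by symmetry the orientation is immaterial. In a connected graph some \<open>r\<close> exists for
  any two nodes, so \<open>LEAST\<close> is meaningful.\<close>

definition pair_dist :: "'a set set \<Rightarrow> 'a set \<Rightarrow> nat" where
  "pair_dist E e = (LEAST r. \<exists>u v. e = {u, v} \<and> (u, v) \<in> step_rel E ^^ r)"

section \<open>Graph distance and ball growth\<close>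

lemma step_rel_relpow_sym: "(u, v) \<in> step_rel E ^^ r \<Longrightarrow> (v, u) \<in> step_rel E ^^ r"
proof (induction r arbitrary: v)
  case (Suc r)
  then obtain w where "(u, w) \<in> step_rel E ^^ r" "(w, v) \<in> step_rel E" by auto
  then have "(v, w) \<in> step_rel E" "(w, u) \<in> step_rel E ^^ r"
    using Suc.IH by (auto simp: step_rel_def insert_commute)
  then show ?case by (rule relpow_Suc_I2)
qed simp

lemma step_rel_relpow_mono:
  assumes "(u, v) \<in> step_rel E ^^ r" "r \<le> s"
  shows "(u, v) \<in> step_rel E ^^ s"
  using assms(2)
proof (induction s rule: dec_induct)
  case (step s)
  have "(v, v) \<in> step_rel E" by (simp add: step_rel_def)
  with step show ?case by auto
qed (rule assms(1))

lemma pair_dist_eq: "pair_dist E {u, v} = (LEAST r. (u, v) \<in> step_rel E ^^ r)"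
proof -
  have "(\<exists>a b. {u, v} = {a, b} \<and> (a, b) \<in> step_rel E ^^ r) \<longleftrightarrow> (u, v) \<in> step_rel E ^^ r" for r
    using step_rel_relpow_sym by (fastforce simp: doubleton_eq_iff)
  then show ?thesis by (simp add: pair_dist_def)
qed

lemma pair_dist_le: "(u, v) \<in> step_rel E ^^ r \<Longrightarrow> pair_dist E {u, v} \<le> r"
  unfolding pair_dist_eq by (rule Least_le)

lemma connected_graph_relpow:
  assumes "connected_graph V E" "u \<in> V" "v \<in> V"
  shows "\<exists>r. (u, v) \<in> step_rel E ^^ r"
proof -
  have "(u, v) \<in> {(a, b). {a, b} \<in> E}\<^sup>*"
    using assms by (simp add: connected_graph_def)
  then have "(u, v) \<in> (step_rel E)\<^sup>*"
    by (rule rtrancl_mono[THEN subsetD, rotated]) (auto simp: step_rel_def)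
  then show ?thesis by (auto elim: rtrancl_imp_relpow)
qed

lemma relpow_pair_dist:
  assumes "connected_graph V E" "u \<in> V" "v \<in> V"
  shows "(u, v) \<in> step_rel E ^^ pair_dist E {u, v}"
  unfolding pair_dist_eq using connected_graph_relpow[OF assms] by (rule LeastI_ex)

text \<open>One step from a node reaches itself and at most \<open>d\<close> neighbours, so each
  step multiplies the ball size by at most d + 1.\<close>

lemma card_ball_le:
  assumes "finite E" and deg: "\<And>v. degree E v \<le> d"
  shows "finite ((step_rel E ^^ r) `` {u}) \<and> card ((step_rel E ^^ r) `` {u}) \<le> (d + 1) ^ r"
proof (induction r)
  case (Suc r)
  let ?B = "(step_rel E ^^ r) `` {u}"
  have nb: "finite (step_rel E `` {w}) \<and> card (step_rel E `` {w}) \<le> d + 1" for w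
  proof -
    let ?N = "{v. {w, v} \<in> E}"
    have inj: "inj_on (\<lambda>v. {w, v}) ?N" by (auto simp: inj_on_def doubleton_eq_iff)
    have sub: "(\<lambda>v. {w, v}) ` ?N \<subseteq> {e \<in> E. w \<in> e}" by auto
    have "finite ?N" using inj_on_finite[OF inj sub] assms(1) by simp
    moreover have "card ?N \<le> d"
      using card_inj_on_le[OF inj sub] assms(1) deg[of w] by (simp add: degree_def)
    moreover have "step_rel E `` {w} = insert w ?N" by (auto simp: step_rel_def)
    ultimately show ?thesis by (simp add: card_insert_if)
  qed
  have eq: "(step_rel E ^^ Suc r) `` {u} = (\<Union>w\<in>?B. step_rel E `` {w})" by auto
  have "card (\<Union>w\<in>?B. step_rel E `` {w}) \<le> (\<Sum>w\<in>?B. card (step_rel E `` {w}))"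
    using Suc by (intro card_UN_le) simp
  also have "\<dots> \<le> card ?B * (d + 1)"
    using nb sum_bounded_above[of ?B "\<lambda>w. card (step_rel E `` {w})" "d + 1"] by simp
  also have "\<dots> \<le> (d + 1) ^ r * (d + 1)"
    using Suc by (intro mult_le_mono1) simp
  finally show ?case unfolding eq using Suc nb by (auto simp: mult.commute)
qed simp

text \<open>Charge each pair to one endpoint; the other lies in the ball of radius \<open>r\<close>
  around it.\<close>

lemma card_close_pairs_le:
  assumes G: "connected_graph V E" and deg: "\<And>v. degree E v \<le> d"
  shows "card {e \<in> node_pairs V. pair_dist E e \<le> r} \<le> card V * (d + 1) ^ r"
proof -
  let ?B = "\<lambda>u. (step_rel E ^^ r) `` {u}"
  have fin: "finite V" "finite E"
    using G simple_graph_finite_edges by (auto simp: connected_graph_def simple_graph_def)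
  note ball = card_ball_le[OF fin(2) deg]
  have "{e \<in> node_pairs V. pair_dist E e \<le> r} \<subseteq> (\<Union>u\<in>V. (\<lambda>v. {u, v}) ` ?B u)"
  proof
    fix e assume e: "e \<in> {e \<in> node_pairs V. pair_dist E e \<le> r}"
    then obtain u v where uv: "e = {u, v}" "u \<in> V" "v \<in> V"
      by (auto simp: node_pairs_def card_2_iff)
    then have "v \<in> ?B u"
      using e step_rel_relpow_mono[OF relpow_pair_dist[OF G uv(2,3)]] by auto
    then show "e \<in> (\<Union>u\<in>V. (\<lambda>v. {u, v}) ` ?B u)" using uv by blast
  qed
  then have "card {e \<in> node_pairs V. pair_dist E e \<le> r} \<le> card (\<Union>u\<in>V. (\<lambda>v. {u, v}) ` ?B u)"
    using fin ball by (intro card_mono) auto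
  also have "\<dots> \<le> (\<Sum>u\<in>V. card ((\<lambda>v. {u, v}) ` ?B u))"
    using fin(1) by (rule card_UN_le)
  also have "\<dots> \<le> (\<Sum>u\<in>V. (d + 1) ^ r)"
    using ball by (intro sum_mono order_trans[OF card_image_le]) auto
  finally show ?thesis by simp
qed

section \<open>Bounds on the LP optimum from above and below\<close>

lemma pair_dist_triangle:
  assumes G: "connected_graph V E" and "i \<in> V" "j \<in> V" "k \<in> V"
  shows "pair_dist E {i, j} \<le> pair_dist E {i, k} + pair_dist E {j, k}"
proof -
  have "(i, k) \<in> step_rel E ^^ pair_dist E {i, k}" "(k, j) \<in> step_rel E ^^ pair_dist E {j, k}"
    using assms by (auto intro: relpow_pair_dist step_rel_relpow_sym)
  then have "(i, j) \<in> step_rel E ^^ (pair_dist E {i, k} + pair_dist E {j, k})"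
    by (auto simp: relpow_add)
  then show ?thesis by (rule pair_dist_le)
qed

lemma lcc_lp_opt_le:
  fixes lam :: real and D :: nat
  assumes G: "connected_graph V E" and deg: "\<And>v. degree E v \<le> d"
    and lam: "0 < lam" "lam < 1" and D: "0 < D"
  shows "lcc_lp_opt V E lam \<le> card E / D + lam * (card V * (d + 1) ^ D)"
proof -
  define x where "x e = min 1 (real (pair_dist E e) / D)" for e
  have G': "simple_graph V E" using G by (simp add: connected_graph_def)
  have fin: "finite V" "finite E"
    using G' simple_graph_finite_edges by (auto simp: simple_graph_def)
  have "x {i, j} \<le> x {i, k} + x {j, k}" if "i \<in> V" "j \<in> V" "k \<in> V" for i j k
  proof -
    have "real (pair_dist E {i, j}) / D \<le> real (pair_dist E {i, k}) / D + real (pair_dist E {j, k}) / D"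
      unfolding add_divide_distrib[symmetric] of_nat_add[symmetric]
      using pair_dist_triangle[OF G that] by (intro divide_right_mono) simp_all
    \<comment> \<open>Truncation at 1 keeps the triangle inequality: once a summand on the right is
      truncated, nonnegativity of the other makes the sum at least 1.\<close>
    moreover have "0 \<le> real (pair_dist E {i, k}) / D" "0 \<le> real (pair_dist E {j, k}) / D" by auto
    ultimately show ?thesis unfolding x_def by linarith
  qed
  then have "triangle_constraints V x" by (simp add: triangle_constraints_def)
  then have x: "x \<in> lcc_lp_feasible V" by (simp add: lcc_lp_feasible_def) (simp add: x_def)
  have "lcc_lp_opt V E lam \<le> lcc_objective V E lam x"
    unfolding lcc_lp_opt_def by (intro cINF_lower x lcc_lp_bdd_below G' lam)
  also have "\<dots> \<le> card E / D + lam * (card V * (d + 1) ^ D)"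
    unfolding lcc_objective_def
  proof (rule add_mono)
    have "(1 - lam) * x e \<le> 1 / D" if "e \<in> E" for e
    proof -
      obtain u v where "e = {u, v}"
        using \<open>e \<in> E\<close> G' unfolding simple_graph_def node_pairs_def card_2_iff by blast
      then have "pair_dist E e \<le> 1"
        using that pair_dist_le[where u = u and v = v and E = E and r = 1] by (simp add: step_rel_def)
      then have "x e \<le> 1 / D" unfolding x_def by (intro min.coboundedI2 divide_right_mono) auto
      moreover have "0 \<le> x e" by (simp add: x_def)
      ultimately show ?thesis using lam mult_mono[of "1 - lam" 1 "x e" "1 / D"] by simp
    qed
    then show "(\<Sum>e\<in>E. (1 - lam) * x e) \<le> card E / D"
      using sum_bounded_above[of E "\<lambda>e. (1 - lam) * x e" "1 / D"] by simp
  next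
    let ?P = "{e \<in> node_pairs V. pair_dist E e \<le> D}"
    have finP: "finite (node_pairs V)" using fin finite_node_pairs by blast
    have "(\<Sum>e\<in>node_pairs V - E. lam * (1 - x e)) \<le> (\<Sum>e\<in>node_pairs V. if pair_dist E e \<le> D then lam else 0)"
    proof (rule order_trans[OF sum_mono])
      fix e
      show "lam * (1 - x e) \<le> (if pair_dist E e \<le> D then lam else 0)"
      proof (cases "pair_dist E e \<le> D")
        case True
        then show ?thesis using lam by (simp add: x_def)
      next
        case False
        then have "x e = 1" using D by (simp add: x_def)
        with False show ?thesis by simp
      qed
      show "(\<Sum>e\<in>node_pairs V - E. if pair_dist E e \<le> D then lam else 0)
          \<le> (\<Sum>e\<in>node_pairs V. if pair_dist E e \<le> D then lam else 0)"
        using finP lam by (intro sum_mono2) auto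
    qed
    also have "\<dots> = lam * card ?P"
      using finP by (simp add: sum.If_cases Int_def)
    also have "\<dots> \<le> lam * (card V * (d + 1) ^ D)"
      using card_close_pairs_le[OF G deg, where r = D] lam
      by (intro mult_left_mono) (simp_all only: of_nat_le_iff less_imp_le)
    finally show "(\<Sum>e\<in>node_pairs V - E. lam * (1 - x e)) \<le> lam * (card V * (d + 1) ^ D)" .
  qed
  finally show ?thesis .
qed

text \<open>Along a path the triangle inequality adds one edge variable per step, each at most the
  whole edge sum. The factor \<open>l\<close> is chosen before \<open>x\<close>, so the bound is
  uniform over the polytope.\<close>

lemma lp_feasible_le_edge_sum:
  assumes G: "simple_graph V E" and path: "(u, v) \<in> {(a, b). {a, b} \<in> E}\<^sup>*"
  shows "\<exists>l::nat. \<forall>x\<in>lcc_lp_feasible V. u \<noteq> v \<longrightarrow> x {u, v} \<le> l * (\<Sum>e\<in>E. x e)"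
  using path
proof (induction rule: rtrancl_induct)
  case base
  then show ?case by simp
next
  case (step v w)
  then obtain l where l: "\<And>x. x \<in> lcc_lp_feasible V \<Longrightarrow> u \<noteq> v \<Longrightarrow> x {u, v} \<le> real l * (\<Sum>e\<in>E. x e)"
    by blast
  have vw: "{v, w} \<in> E" using step by simp
  then have V: "v \<in> V" "w \<in> V" "v \<noteq> w"
    using G by (auto simp: simple_graph_def node_pairs_def card_2_iff doubleton_eq_iff)
  have uV: "u \<in> V"
    using \<open>(u, v) \<in> {(a, b). {a, b} \<in> E}\<^sup>*\<close>
  proof (cases rule: converse_rtranclE)
    case (step z)
    then show ?thesis using G by (auto simp: simple_graph_def node_pairs_def)
  qed (use V in simp)
  have "x {u, w} \<le> real (Suc l) * (\<Sum>e\<in>E. x e)" if x: "x \<in> lcc_lp_feasible V" and "u \<noteq> w" for x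
  proof -
    have pos: "0 \<le> x e" if "e \<in> E" for e
      using that x G by (auto simp: simple_graph_def lcc_lp_feasible_def)
    have e: "x {v, w} \<le> (\<Sum>e\<in>E. x e)"
      using vw pos simple_graph_finite_edges[OF G] by (intro member_le_sum) auto
    have s: "0 \<le> real l * (\<Sum>e\<in>E. x e)" using pos by (intro mult_nonneg_nonneg sum_nonneg) auto
    show ?thesis
    proof (cases "u = v")
      case True
      then show ?thesis using e s by (simp add: algebra_simps)
    next
      case False
      have "x {u, w} \<le> x {u, v} + x {w, v}"
        using x False \<open>u \<noteq> w\<close> V uV by (auto simp: lcc_lp_feasible_def triangle_constraints_def)
      then show ?thesis using l[OF x False] e by (simp add: algebra_simps insert_commute)
    qed
  qed
  then show ?case by blast
qed

text \<open>Rules out a gap that is a division by zero. For a non-adjacent pair \<open>e\<close>, a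
  small \<open>x e\<close> makes \<open>e\<close> expensive and a large one forces a large edge sum;
  positivity of the infimum needs a bound \<open>c\<close> independent of \<open>x\<close>.\<close>

lemma lcc_lp_opt_pos:
  assumes G: "connected_graph V E" and e: "e \<in> node_pairs V - E" and lam: "0 < lam" "lam < 1"
  shows "0 < lcc_lp_opt V E lam"
proof -
  have G': "simple_graph V E" using G by (simp add: connected_graph_def)
  have fin: "finite (node_pairs V)" "E \<subseteq> node_pairs V"
    using G' finite_node_pairs by (auto simp: simple_graph_def)
  obtain u v where uv: "e = {u, v}" "u \<noteq> v" "u \<in> V" "v \<in> V"
    using e by (auto simp: node_pairs_def card_2_iff)
  then have "(u, v) \<in> {(a, b). {a, b} \<in> E}\<^sup>*" using G by (auto simp: connected_graph_def)
  then obtain l :: nat where l: "\<And>x. x \<in> lcc_lp_feasible V \<Longrightarrow> x e \<le> real l * (\<Sum>e\<in>E. x e)"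
    using lp_feasible_le_edge_sum[OF G'] uv by blast
  \<comment> \<open>Splitting c = c * x e + c * (1 - x e), the first part is paid by the edges as c
    * l <= 1 - lam, the second by the non-edge \<open>e\<close> as c <= lam.\<close>
  define c where "c = min lam ((1 - lam) / (l + 1))"
  have c: "0 < c" "c \<le> lam" using lam by (auto simp: c_def)
  have "c \<le> (1 - lam) / (l + 1)" by (simp add: c_def)
  then have cl: "c * (l + 1) \<le> 1 - lam" by (simp add: pos_le_divide_eq)
  have "c \<le> lcc_objective V E lam x" if x: "x \<in> lcc_lp_feasible V" for x
  proof -
    let ?s = "\<Sum>e\<in>E. x e"
    have x01: "0 \<le> x e" "x e \<le> 1" if "e \<in> node_pairs V" for e
      using x that by (auto simp: lcc_lp_feasible_def)
    have s: "0 \<le> ?s" using x01 fin by (intro sum_nonneg) auto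
    have "c * l * ?s \<le> (1 - lam) * ?s"
      using c cl s by (intro mult_right_mono) (auto simp: algebra_simps)
    moreover have "c * x e \<le> c * (l * ?s)" using l[OF x] c by (intro mult_left_mono) auto
    moreover have "c * (1 - x e) \<le> lam * (1 - x e)"
      using c x01 e by (intro mult_right_mono) auto
    moreover have "lam * (1 - x e) \<le> (\<Sum>e\<in>node_pairs V - E. lam * (1 - x e))"
      using fin e x01 lam by (intro member_le_sum) auto
    moreover have "(\<Sum>e\<in>E. (1 - lam) * x e) = (1 - lam) * ?s" by (simp add: sum_distrib_left)
    ultimately show ?thesis
      unfolding lcc_objective_def by (simp add: algebra_simps)
  qed
  then have "c \<le> lcc_lp_opt V E lam"
    unfolding lcc_lp_opt_def
    using lcc_ip_feasible_nonempty lcc_ip_feasible_subset by (intro cINF_greatest) blast+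
  with c show ?thesis by simp
qed

section \<open>The integrality gap\<close>

text \<open>With 2425 = 2424 + 1, this \<open>n\<close> makes the bound 2425^D on balls of radius
  \<open>D\<close> equal to the square root of n. The LP costs at most 102 n / D, the integer
  program at least n/36, and 3672 = 36 * 102.\<close>

lemma ex_gap_instance:
  fixes D n :: nat
  assumes D: "0 < D" and n: "n = 2425 ^ (2 * D)"
  shows "\<exists>E::nat set set. connected_graph {..<n} E \<and> 0 < lcc_lp_opt {..<n} E (1 / n) \<and>
    D / 3672 * lcc_lp_opt {..<n} E (1 / n) \<le> lcc_ip_opt {..<n} E (1 / n)"
proof -
  have "(2425::nat) ^ 2 \<le> 2425 ^ (2 * D)" using D by (intro power_increasing) auto
  then have big: "5880625 \<le> n" using n by simp
  then obtain E where E: "connected_graph {..<n} E" "card E \<le> 101 * n" "\<And>v. degree E v \<le> 2424"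
      "\<And>S. balanced {..<n} S \<Longrightarrow> n < card (cut E S)"
    using ex_balanced_expander[of n] by fastforce
  have G: "simple_graph {..<n} E" using E by (simp add: connected_graph_def)
  have lam: "0 < 1 / real n" "1 / real n < 1" using big by auto
  \<comment> \<open>There are more pairs than edges, so a non-edge exists, as positivity of the LP
    optimum requires.\<close>
  have "101 * real n < real n * (real n - 1) / 2"
    using big mult_strict_left_mono[of 202 "real n - 1" "real n"] by simp
  moreover have "real (card E) \<le> 101 * real n" using E(2) by linarith
  ultimately have "real (card E) < card (node_pairs {..<n})"
    using real_card_node_pairs[of "{..<n}"] by simp
  then have "\<not> node_pairs {..<n} \<subseteq> E"
    using card_mono[OF simple_graph_finite_edges[OF G], of "node_pairs {..<n}"] by auto
  then have pos: "0 < lcc_lp_opt {..<n} E (1 / n)"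
    using lcc_lp_opt_pos[OF E(1) _ lam] by blast
  have "lcc_lp_opt {..<n} E (1 / n) \<le> card E / D + 1 / n * (n * 2425 ^ D)"
    using lcc_lp_opt_le[OF E(1) E(3) lam D] by simp
  also have "\<dots> \<le> 101 * n / D + n / D"
  proof (rule add_mono)
    show "card E / D \<le> 101 * n / D"
      using E(2) by (intro divide_right_mono) auto
    \<comment> \<open>Since \<open>D\<close> is at most 2425^D, the square root of n, the non-edge
      cost is at most n / D.\<close>
    have "real D \<le> 2 ^ D" by (rule less_imp_le[OF of_nat_less_two_power])
    also have "\<dots> \<le> 2425 ^ D" by (rule power_mono) auto
    finally have "real D \<le> 2425 ^ D" .
    moreover have "real n = 2425 ^ D * 2425 ^ D" by (simp add: n mult_2 power_add)
    ultimately have "2425 ^ D * real D \<le> real n" by simp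
    then show "1 / n * (n * 2425 ^ D) \<le> n / D" using D big by (simp add: field_simps)
  qed
  finally have "D * lcc_lp_opt {..<n} E (1 / n) \<le> 102 * n"
    using D by (simp add: field_simps)
  moreover have "n / 36 \<le> lcc_ip_opt {..<n} E (1 / n)"
    using lcc_ip_opt_ge[OF G] E big by simp
  ultimately show ?thesis using E(1) pos by (intro exI[of _ E]) auto
qed

theorem theorem1:
  "\<exists>C::real. C > 0 \<and>
     infinite {n::nat. \<exists>(V::nat set) (E::nat set set) (lam::real).
       connected_graph V E \<and> card V = n \<and> 0 < lam \<and> lam < 1 \<and>
       0 < lcc_lp_opt V E lam \<and>
       lcc_ip_opt V E lam \<ge> C * ln (real n) * lcc_lp_opt V E lam \<and>
       lcc_integrality_gap V E lam \<ge> C * ln (real n)}"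
proof -
  \<comment> \<open>As ln n = 2 D ln 2425 and 7344 = 2 * 3672, this gives C ln n = D / 3672
    exactly.\<close>
  define C :: real where "C = 1 / (7344 * ln 2425)"
  let ?N = "{n::nat. \<exists>(V::nat set) (E::nat set set) (lam::real).
       connected_graph V E \<and> card V = n \<and> 0 < lam \<and> lam < 1 \<and>
       0 < lcc_lp_opt V E lam \<and>
       lcc_ip_opt V E lam \<ge> C * ln (real n) * lcc_lp_opt V E lam \<and>
       lcc_integrality_gap V E lam \<ge> C * ln (real n)}"
  have "2425 ^ (2 * D) \<in> ?N" if D: "0 < D" for D
  proof -
    define n :: nat where "n = 2425 ^ (2 * D)"
    obtain E :: "nat set set" where E: "connected_graph {..<n} E" "0 < lcc_lp_opt {..<n} E (1 / n)"
        "D / 3672 * lcc_lp_opt {..<n} E (1 / n) \<le> lcc_ip_opt {..<n} E (1 / n)"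
      using ex_gap_instance[OF D n_def] by blast
    have "1 < n" using D one_less_power[of "2425::nat" "2 * D"] by (simp add: n_def)
    have "C * ln (real n) = D / 3672"
      by (simp add: C_def n_def ln_realpow)
    with E(3) have "C * ln (real n) * lcc_lp_opt {..<n} E (1 / n) \<le> lcc_ip_opt {..<n} E (1 / n)"
      by (simp only:)
    then show ?thesis
      unfolding mem_Collect_eq n_def[symmetric] lcc_integrality_gap_def
      using E(1,2) \<open>1 < n\<close>
      by (intro exI[of _ "{..<n}"] exI[of _ E] exI[of _ "1 / real n"] conjI)
        (simp_all add: pos_le_divide_eq)
  qed
  then have "(\<lambda>D. 2425 ^ (2 * D)) ` {0<..} \<subseteq> ?N" by blast
  moreover have "infinite ((\<lambda>D. 2425 ^ (2 * D) :: nat) ` {0<..})"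
    by (subst finite_image_iff) (auto simp: inj_on_def infinite_Ioi)
  ultimately have "infinite ?N" using finite_subset by blast
  moreover have "C > 0" by (simp add: C_def)
  ultimately show ?thesis by blast
qed

end
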